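(* Let $\{f_n\}_{n\ge 1}$ be a consecutive polynomial sequence over $\mathbb{F}_q$ of infinite length. For any integers $n\ge 2q-1$ and $d$ satisfying $0<d\le \frac{\log((n+1)/2)}{\log q}$, we have $$\max\{D(f_n),D(f_{n+d})\} > \frac{\log((n+1)/2)+ \log\log q - \log\log ((n+1)/2)}{\log q}.$$ Moreover, if $p \nmid n+1$ or $p \nmid d$, then $$\max\{D(f_n),D(f_{n+d})\} > \frac{\log((n+1)/2)}{\log q}.$$
   Context: Let $p$ be an odd prime, $q=p^s$ with $s\ge 1$ an integer, and $\mathbb{F}_q$ the finite field with $q$ elements. Given an infinite sequence $\{u_n\}_{n\ge 0}$ of non-zero elements of $\mathbb{F}_q$, the associated consecutive polynomial sequence (of infinite length) is $\{f_n\}_{n\ge 1}$, where $f_n=u_nX^n+\cdots+u_1X+u_0\in\mathbb{F}_q[X]$. For $n\ge 1$, $D(f_n)$ denotes the largest degree of the irreducible factors of $f_n$ over $\mathbb{F}_q$. Logarithms are natural. *)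

theory Defs
  imports Complex_Main "HOL-Computational_Algebra.Computational_Algebra"
begin

text \<open>The sequence starts at index \<open>n = 1\<close>; the value \<open>f 0\<close> is left unconstrained.\<close>

definition consecutive_poly_seq :: "(nat \<Rightarrow> 'a::field poly) \<Rightarrow> bool" where
  "consecutive_poly_seq f \<longleftrightarrow>
     (\<exists>u :: nat \<Rightarrow> 'a. (\<forall>i. u i \<noteq> 0) \<and> (\<forall>n\<ge>1. f n = (\<Sum>i\<le>n. monom (u i) i)))"

text \<open>For a non-constant \<open>f\<close> the set below is nonempty and bounded by \<open>degree f\<close>, so the maximum
  is meaningful; it is not meaningful for constant \<open>f\<close>.\<close>

definition max_irred_degree :: "'a::field poly \<Rightarrow> nat" where
  "max_irred_degree f = Max (degree ` {g. irreducible g \<and> g dvd f})"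

end

theory Submission
  imports Defs
begin

text \<open>Let \<open>A = f\<^sub>n\<close>, \<open>C = f\<^bsub>n+d\<^esub>\<close>, and let \<open>M\<close> be the larger of their maximal irreducible degrees.
  Every irreducible factor of \<open>A C\<close> divides \<open>R\<close>, the product of the \<open>X^(q^i) - X\<close> for
  \<open>1 \<le> i \<le> M\<close>, whose degree is less than \<open>2 q^M\<close>. Hence \<open>A\<close> divides \<open>A' R\<close> and \<open>C\<close> divides \<open>C' R\<close>,
  so \<open>A C\<close> divides \<open>W R\<close> for the Wronskian \<open>W = A' C - A C'\<close>. Since \<open>X^(n+1)\<close> divides \<open>C - A\<close>,
  also \<open>X^n\<close> divides \<open>W\<close>, and it is coprime to \<open>A C\<close>. If \<open>W \<noteq> 0\<close>, comparing degrees gives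
  \<open>n + 1 \<le> deg R < 2 q^M\<close>. If \<open>W = 0\<close>, then \<open>C / A\<close> is a \<open>p\<close>-th power \<open>(E / A)^p\<close>, and passing from
  \<open>(A, C)\<close> to \<open>(A, E)\<close> divides both \<open>n + 1\<close> and \<open>d\<close> by \<open>p\<close>; after \<open>k\<close> such steps
  \<open>n + 1 \<le> p^k deg R\<close> with \<open>p^k\<close> dividing \<open>n + 1\<close> and \<open>d\<close>, so \<open>p^k \<le> d\<close>.\<close>

section \<open>Characteristic and \<open>p\<close>-th roots over a finite field\<close>

text \<open>Translation by 1 permutes the field and so preserves the sum of all elements; hence the
  cardinality vanishes in the field.\<close>

lemma prime_card_imp_CHAR:
  assumes "prime p" and "card (UNIV :: 'a::{field, finite} set) = p ^ s"
  shows "CHAR('a) = p"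
proof -
  have "(\<Sum>x\<in>UNIV. x) = (\<Sum>x\<in>UNIV. x + 1 :: 'a)"
    by (rule sum.reindex_bij_witness[of _ "\<lambda>x. x + 1" "\<lambda>x. x - 1"]) auto
  then have "of_nat (card (UNIV :: 'a set)) = (0 :: 'a)"
    by (simp add: sum.distrib)
  then have "CHAR('a) dvd p ^ s"
    unfolding assms(2) of_nat_eq_0_iff_char_dvd .
  moreover have "prime CHAR('a)"
    by (rule prime_CHAR_semidom) (simp add: finite_imp_CHAR_pos)
  ultimately show ?thesis
    using assms(1) prime_dvd_power primes_dvd_imp_eq by blast
qed

text \<open>Frobenius is additive with trivial kernel, hence injective, hence surjective on a finite
  set.\<close>

lemma finite_field_exists_root_CHAR:
  fixes x :: "'a::{field, finite}"
  shows "\<exists>y. y ^ CHAR('a) = x"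
proof -
  have pr: "prime CHAR('a)"
    by (rule prime_CHAR_semidom) (simp add: finite_imp_CHAR_pos)
  have "inj (\<lambda>y :: 'a. y ^ CHAR('a))"
  proof (rule injI)
    fix y z :: 'a
    assume eq: "y ^ CHAR('a) = z ^ CHAR('a)"
    have "((y - z) + z) ^ CHAR('a) = (y - z) ^ CHAR('a) + z ^ CHAR('a)"
      using pr by (rule freshmans_dream) simp
    with eq show "y = z"
      using prime_gt_0_nat[OF pr] by simp
  qed
  then have "surj (\<lambda>y :: 'a. y ^ CHAR('a))"
    by (simp add: finite_UNIV_inj_surj)
  then show ?thesis
    by (metis surjD)
qed

text \<open>A zero derivative leaves only exponents divisible by the characteristic. Every
  coefficient is a \<open>p\<close>-th power, so the freshman's dream lets \<open>E\<close> be
  assembled from roots of the coefficients.\<close>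

lemma pderiv_eq_0_imp_CHAR_power:
  fixes F :: "'a::{field, finite} poly"
  assumes "pderiv F = 0"
  obtains E where "F = E ^ CHAR('a)"
proof -
  let ?p = "CHAR('a)"
  have pr: "prime ?p"
    by (rule prime_CHAR_semidom) (simp add: finite_imp_CHAR_pos)
  obtain r :: "'a \<Rightarrow> 'a" where r: "\<And>x. r x ^ ?p = x"
    using finite_field_exists_root_CHAR by metis
  \<comment> \<open>The range is generous: indices with \<open>?p * j\<close> beyond
    \<open>degree F\<close> contribute zero.\<close>
  define E where "E = (\<Sum>j\<le>degree F. monom (r (coeff F (?p * j))) j)"
  have coeff0: "coeff F i = 0" if "\<not> ?p dvd i" for i
  proof -
    have "i \<noteq> 0" using that by (metis dvd_0_right)
    then have "of_nat i * coeff F i = 0"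
      using arg_cong[OF assms, of "\<lambda>G. coeff G (i - 1)"] by (simp add: coeff_pderiv)
    with that show ?thesis
      by (simp add: of_nat_eq_0_iff_char_dvd)
  qed
  have "E ^ ?p = (\<Sum>j\<le>degree F. monom (r (coeff F (?p * j))) j ^ ?p)"
    unfolding E_def using pr by (intro freshmans_dream_sum) auto
  also have "\<dots> = (\<Sum>j\<le>degree F. monom (coeff F (?p * j)) (?p * j))"
    by (simp add: monom_power r mult.commute)
  also have "\<dots> = F"
  proof (rule poly_eqI)
    fix i
    show "coeff (\<Sum>j\<le>degree F. monom (coeff F (?p * j)) (?p * j)) i = coeff F i"
    proof (cases "?p dvd i")
      case True
      then obtain j where i: "i = ?p * j" ..
      have "coeff (\<Sum>j\<le>degree F. monom (coeff F (?p * j)) (?p * j)) i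
          = (\<Sum>k\<le>degree F. if k = j then coeff F (?p * k) else 0)"
        unfolding coeff_sum using prime_gt_0_nat[OF pr] by (intro sum.cong) (auto simp: i)
      also have "\<dots> = (if j \<le> degree F then coeff F (?p * j) else 0)"
        by simp
      also have "\<dots> = coeff F i"
      proof (cases "j \<le> degree F")
        case False
        moreover have "j \<le> ?p * j" using prime_gt_0_nat[OF pr] by simp
        ultimately have "degree F < ?p * j" by linarith
        then show ?thesis using False by (simp add: i coeff_eq_0)
      qed (simp add: i)
      finally show ?thesis .
    next
      case False
      have "coeff (\<Sum>j\<le>degree F. monom (coeff F (?p * j)) (?p * j)) i = 0"
        unfolding coeff_sum using False by (intro sum.neutral) (auto)
      with False show ?thesis by (simp add: coeff0)
    qed
  qed
  finally show ?thesis using that by metis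
qed

section \<open>Irreducible polynomials of degree \<open>m\<close> divide
  \<open>X^(q^m) - X\<close>\<close>

text \<open>A condition on coefficients is used because \<open>degree g < m\<close> would exclude
  the zero polynomial when \<open>m = 0\<close>.\<close>

lemma finite_field_card_degree_less:
  shows "finite {g :: 'a::{field, finite} poly. \<forall>i\<ge>m. coeff g i = 0}"
    and "card {g :: 'a poly. \<forall>i\<ge>m. coeff g i = 0} = card (UNIV :: 'a set) ^ m"
proof -
  have "finite {g :: 'a poly. \<forall>i\<ge>m. coeff g i = 0}
      \<and> card {g :: 'a poly. \<forall>i\<ge>m. coeff g i = 0} = card (UNIV :: 'a set) ^ m"
  proof (induction m)
    case 0
    have "{g :: 'a poly. \<forall>i\<ge>0. coeff g i = 0} = {0}"
      by (auto simp: poly_eq_iff)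
    then show ?case by simp
  next
    case (Suc m)
    let ?S = "\<lambda>m. {g :: 'a poly. \<forall>i\<ge>m. coeff g i = 0}"
    have "g \<in> (\<lambda>(a, g). pCons a g) ` (UNIV \<times> ?S m)" if "g \<in> ?S (Suc m)" for g
    proof -
      obtain a h where "g = pCons a h" by (cases g)
      moreover have "coeff h i = 0" if "i \<ge> m" for i
        using that \<open>g \<in> ?S (Suc m)\<close> \<open>g = pCons a h\<close> by (auto dest: spec[of _ "Suc i"])
      ultimately show ?thesis by force
    qed
    then have eq: "?S (Suc m) = (\<lambda>(a, g). pCons a g) ` (UNIV \<times> ?S m)"
      by (auto simp: coeff_pCons split: nat.splits)
    have "inj_on (\<lambda>(a, g). pCons a g) (UNIV \<times> ?S m)"
      by (auto simp: inj_on_def)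
    with Suc show ?case
      by (simp add: eq card_image card_cartesian_product)
  qed
  then show "finite {g :: 'a poly. \<forall>i\<ge>m. coeff g i = 0}"
    and "card {g :: 'a poly. \<forall>i\<ge>m. coeff g i = 0} = card (UNIV :: 'a set) ^ m"
    by auto
qed

text \<open>Multiplication by \<open>X\<close> permutes the nonzero residues modulo \<open>g\<close>, so comparing the products
  over all of them gives \<open>X^(q^m - 1) = 1\<close> modulo \<open>g\<close>, where \<open>m\<close> is the degree of \<open>g\<close>.\<close>

lemma irreducible_dvd_monom_card_power:
  fixes g :: "'a::{field, finite} poly"
  assumes "irreducible g"
  shows "g dvd monom 1 (card (UNIV :: 'a set) ^ degree g) - monom 1 1"
proof (cases "g dvd monom 1 1")
  case True
  have "card (UNIV :: 'a set) ^ degree g > 0"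
    by (simp add: finite_UNIV_card_ge_0)
  then have "monom (1::'a) 1 dvd monom 1 (card (UNIV :: 'a set) ^ degree g)"
    by (subst monom_1_dvd_iff) auto
  with True show ?thesis
    by (meson dvd_diff dvd_trans)
next
  case False
  let ?Q = "card (UNIV :: 'a set) ^ degree g" and ?X = "monom (1::'a) 1"
  have pr: "prime_elem g" using assms by (rule field_poly_irreducible_imp_prime)
  have g0: "g \<noteq> 0" using assms by auto
  have deg: "degree g > 0"
    using assms g0 by (auto simp: irreducible_def is_unit_iff_degree)
  define S where "S = {h :: 'a poly. \<forall>i\<ge>degree g. coeff h i = 0} - {0}"
  have fin: "finite S" and card: "card S = ?Q - 1"
    using finite_field_card_degree_less[where 'a='a, of "degree g"]
    by (auto simp: S_def card_Diff_singleton)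
  have S_iff: "h \<in> S \<longleftrightarrow> h \<noteq> 0 \<and> degree h < degree g" for h
    using deg by (auto simp: S_def coeff_eq_0) (metis leading_coeff_0_iff not_le)
  have not_dvd: "\<not> g dvd h" if "h \<in> S" for h
    using that by (auto simp: S_iff dest: dvd_imp_degree_le)
  have "\<not> g dvd \<Prod>T" if "finite T" "T \<subseteq> S" for T
    using that by (induction T) (use pr not_dvd in \<open>auto simp: prime_elem_dvd_mult_iff\<close>)
  then have not_dvd_prod: "\<not> g dvd \<Prod>S" using fin by blast
  let ?f = "\<lambda>h. (?X * h) mod g"
  have maps: "?f h \<in> S" if "h \<in> S" for h
  proof -
    have "\<not> g dvd ?X * h"
      using pr False not_dvd[OF that] by (simp add: prime_elem_dvd_mult_iff)
    then show ?thesis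
      using degree_mod_less'[OF g0, of "?X * h"] by (auto simp: S_iff dvd_eq_mod_eq_0)
  qed
  have inj: "inj_on ?f S"
  proof (rule inj_onI)
    fix h k assume hk: "h \<in> S" "k \<in> S" "?f h = ?f k"
    then have "g dvd ?X * h - ?X * k" by (simp add: mod_eq_dvd_iff)
    then have "g dvd ?X * (h - k)" by (simp add: right_diff_distrib)
    then have "g dvd h - k" using pr False prime_elem_dvd_multD by blast
    then show "h = k"
      using hk(1,2) by (metis S_iff degree_diff_less dvd_imp_degree_le not_le right_minus_eq)
  qed
  have "?f ` S = S"
    using maps by (intro endo_inj_surj fin inj) auto
  with inj have "bij_betw ?f S S" by (simp add: bij_betw_def)
  then have perm: "(\<Prod>h\<in>S. ?f h) = \<Prod>S"
    by (rule prod.reindex_bij_betw[where g = "\<lambda>h. h"])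
  have "(\<Prod>h\<in>S. ?X * h) mod g = (\<Prod>h\<in>S. ?f h) mod g"
    by (rule mod_prod_eq[symmetric])
  also have "\<dots> = \<Prod>S mod g"
    by (simp only: perm)
  finally have "?X ^ (?Q - 1) * \<Prod>S mod g = \<Prod>S mod g"
    by (simp add: prod.distrib card)
  then have "g dvd ?X ^ (?Q - 1) * \<Prod>S - \<Prod>S"
    by (simp add: mod_eq_dvd_iff)
  then have "g dvd (?X ^ (?Q - 1) - 1) * \<Prod>S"
    by (simp add: left_diff_distrib)
  then have "g dvd ?X ^ (?Q - 1) - 1"
    using pr not_dvd_prod prime_elem_dvd_multD by blast
  then have "g dvd ?X * (?X ^ (?Q - 1) - 1)" by simp
  also have "?X * (?X ^ (?Q - 1) - 1) = ?X ^ Suc (?Q - 1) - ?X"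
    by (simp add: right_diff_distrib)
  also have "?X ^ Suc (?Q - 1) = monom 1 ?Q"
    by (simp add: monom_power finite_UNIV_card_ge_0 del: power_Suc)
  finally show ?thesis .
qed

section \<open>The Wronskian bound\<close>

text \<open>A factor of multiplicity \<open>e\<close> in \<open>A\<close> divides
  \<open>pderiv A\<close> at least \<open>e - 1\<close> times, and \<open>R\<close> supplies the
  missing one. Splitting \<open>A\<close> and using the product rule avoids any mention of
  multiplicities.\<close>

lemma dvd_pderiv_mult:
  fixes A R :: "'a::field poly"
  assumes "A \<noteq> 0" and "\<And>g. irreducible g \<Longrightarrow> g dvd A \<Longrightarrow> g dvd R"
  shows "A dvd pderiv A * R"
  using assms
proof (induction "degree A" arbitrary: A rule: less_induct)
  case less
  consider "is_unit A" | "irreducible A" | B C where "A = B * C" "\<not> is_unit B" "\<not> is_unit C"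
    using less.prems(1) by (auto simp: irreducible_def)
  then show ?case
  proof cases
    case 3
    then have "B \<noteq> 0" "C \<noteq> 0" using less.prems(1) by auto
    then have "degree B > 0" "degree C > 0"
      using 3 by (auto simp: is_unit_iff_degree)
    then have "degree B < degree A" "degree C < degree A"
      using \<open>B \<noteq> 0\<close> \<open>C \<noteq> 0\<close> 3(1) by (auto simp: degree_mult_eq)
    then have "B dvd pderiv B * R" "C dvd pderiv C * R"
      using less.prems(2) \<open>B \<noteq> 0\<close> \<open>C \<noteq> 0\<close> 3(1) by (auto intro!: less.hyps)
    then have "B * C dvd B * (pderiv C * R) + (pderiv B * R) * C"
      by (intro dvd_add mult_dvd_mono) auto
    then show ?thesis by (simp add: 3(1) pderiv_mult algebra_simps)
  qed (use unit_imp_dvd less.prems(2) in auto)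
qed

lemma degree_pderiv_mult_less:
  fixes A C :: "'a::field poly"
  assumes "degree A + degree C > 0"
  shows "degree (pderiv A * C) < degree A + degree C"
proof (cases "degree A = 0")
  case True
  then have "pderiv A = 0"
    by (metis degree_eq_zeroE pderiv_pCons pderiv_0 add_0 pCons_0_0)
  with assms show ?thesis by simp
next
  case False
  have "degree (pderiv A) \<le> degree A - 1"
    by (rule degree_le) (auto simp: coeff_pderiv coeff_eq_0)
  with False have "degree (pderiv A) < degree A" by simp
  then show ?thesis
    using degree_mult_le[of "pderiv A" C] by simp
qed

text \<open>Substituting \<open>C = A + X^(n+1) g\<close> cancels the products of \<open>A\<close>
  and its derivative; each remaining term contains \<open>X^(n+1)\<close> or its derivative.\<close>

lemma monom_dvd_wronskian:
  fixes A C :: "'a::field poly"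
  assumes "monom 1 (Suc n) dvd C - A"
  shows "monom 1 n dvd pderiv A * C - A * pderiv C"
proof -
  obtain g where "C - A = monom 1 (Suc n) * g" using assms ..
  then have C: "C = A + monom 1 (Suc n) * g" by (simp add: algebra_simps)
  have X: "monom (1::'a) (Suc n) = monom 1 n * monom 1 1" by (simp add: mult_monom)
  have "pderiv A * C - A * pderiv C
      = monom 1 (Suc n) * (pderiv A * g - A * pderiv g) - pderiv (monom 1 (Suc n)) * (A * g)"
    by (simp add: C pderiv_add pderiv_mult algebra_simps)
  moreover have "monom 1 n dvd pderiv (monom (1::'a) (Suc n))"
    by (simp add: pderiv_monom monom_1_dvd_iff')
  moreover have "monom 1 n dvd monom (1::'a) (Suc n)"
    by (simp add: monom_1_dvd_iff')
  ultimately show ?thesis by (metis dvd_diff dvd_mult2)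
qed

text \<open>A variant of the Mason--Stothers inequality that needs no coprimality: the Wronskian is
  divisible by the repeated parts of \<open>A\<close> and \<open>C\<close>, and by \<open>X\<^sup>n\<close>.\<close>

lemma wronskian_bound:
  fixes A C R :: "'a::field poly"
  assumes "R \<noteq> 0" and A0: "coeff A 0 \<noteq> 0" and deg: "degree A < degree C"
    and irr: "\<And>g. irreducible g \<Longrightarrow> g dvd A * C \<Longrightarrow> g dvd R"
    and W: "pderiv A * C \<noteq> A * pderiv C"
  shows "order 0 (C - A) \<le> degree R"
proof (cases "order 0 (C - A)")
  case (Suc n)
  let ?W = "pderiv A * C - A * pderiv C"
  have X: "monom 1 (Suc n) dvd C - A"
    using deg by (subst monom_1_dvd_iff) (auto simp: Suc)
  then have "coeff (C - A) 0 = 0"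
    unfolding monom_1_dvd_iff' by blast
  then have C0: "coeff C 0 \<noteq> 0" using A0 by simp
  have nz: "A \<noteq> 0" "C \<noteq> 0" using A0 C0 by auto
  have "A dvd pderiv A * R" "C dvd pderiv C * R"
    using irr nz by (auto intro!: dvd_pderiv_mult)
  then have "A * C dvd (pderiv A * R) * C - A * (pderiv C * R)"
    by (intro dvd_diff mult_dvd_mono) auto
  then have "A * C dvd ?W * R" by (simp add: algebra_simps)
  then obtain h where h: "?W * R = A * C * h" ..
  have WR: "?W * R \<noteq> 0" using W assms(1) by simp
  \<comment> \<open>Neither \<open>A\<close> nor \<open>C\<close> vanishes at 0, so every factor
    \<open>X\<close> of \<open>?W * R\<close> lies in the cofactor \<open>h\<close>.\<close>
  have "order 0 (A * C) = 0"
    using A0 C0 by (intro order_0I) (simp add: poly_0_coeff_0 coeff_mult_0)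
  then have "order 0 h = order 0 (?W * R)"
    using WR unfolding h by (subst order_mult) auto
  also have "\<dots> \<ge> n"
    using monom_dvd_wronskian[OF X] WR by (metis dvd_mult2 monom_1_dvd_iff)
  finally have "n \<le> degree h"
    using WR h order_degree[of h 0] by fastforce
  moreover have "degree ?W + degree R = degree A + degree C + degree h"
  proof -
    have "h \<noteq> 0" using WR h by auto
    then have "degree (A * C * h) = degree A + degree C + degree h"
      using nz by (simp add: degree_mult_eq)
    moreover have "degree (?W * R) = degree ?W + degree R"
      using W assms(1) by (intro degree_mult_eq) auto
    ultimately show ?thesis by (simp only: h)
  qed
  \<comment> \<open>Strictness here yields \<open>degree h < degree R\<close>, which improves
    \<open>n\<close> to \<open>Suc n\<close> in the final bound.\<close>
  moreover have "degree ?W < degree A + degree C"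
    using degree_pderiv_mult_less[of A C] degree_pderiv_mult_less[of C A] deg
    by (intro degree_diff_less) (auto simp: ac_simps)
  ultimately show ?thesis using Suc by linarith
qed simp

section \<open>Descent through \<open>p\<close>-th powers when the Wronskian vanishes\<close>

lemma order_power:
  fixes A :: "'a::idom poly"
  assumes "A \<noteq> 0"
  shows "order a (A ^ n) = n * order a A"
  using assms by (induction n) (auto simp: order_mult order_0I)

text \<open>Strong induction on the degree gap \<open>d\<close> with \<open>A\<close> fixed: a
  vanishing Wronskian makes \<open>C * A^(p-1)\<close> a power \<open>E^p\<close>, and replacing
  \<open>C\<close> by \<open>E\<close> divides both the gap and the order by
  \<open>p\<close>.\<close>

lemma order_diff_le_CHAR_power:
  fixes A C R :: "'a::{field, finite} poly"
  assumes "R \<noteq> 0" and "coeff A 0 \<noteq> 0" and "degree C = degree A + d" and "d > 0"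
    and "\<And>g. irreducible g \<Longrightarrow> g dvd A * C \<Longrightarrow> g dvd R"
  shows "\<exists>k. CHAR('a) ^ k dvd order 0 (C - A) \<and> CHAR('a) ^ k dvd d
           \<and> order 0 (C - A) \<le> CHAR('a) ^ k * degree R"
  using assms(3-)
proof (induction d arbitrary: C rule: less_induct)
  case (less d)
  let ?p = "CHAR('a)"
  have "A \<noteq> C" using less.prems(1,2) by auto
  have pr: "prime ?p"
    by (rule prime_CHAR_semidom) (simp add: finite_imp_CHAR_pos)
  then have p2: "?p \<ge> 2" by (rule prime_ge_2_nat)
  show ?case
  proof (cases "pderiv A * C = A * pderiv C")
    case False
    then have "order 0 (C - A) \<le> degree R"
      using less.prems assms(1,2) by (intro wronskian_bound) auto
    then show ?thesis by (intro exI[of _ 0]) simp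
  next
    case True
    have nz: "A \<noteq> 0" "C \<noteq> 0" using assms(2) less.prems(1,2) by auto
    obtain m where m: "?p = Suc (Suc m)"
      using p2 by (metis add_2_eq_Suc le_Suc_ex)
    \<comment> \<open>Since \<open>Suc m = p - 1\<close> acts as -1, the derivative of
      \<open>C * A ^ Suc m\<close> becomes a multiple of the Wronskian.\<close>
    have "of_nat ?p = (0 :: 'a poly)" by (simp only: of_nat_eq_0_iff_char_dvd semiring_char_poly dvd_refl)
    then have p0: "of_nat (Suc m) = (-1 :: 'a poly)"
      unfolding m by (simp add: eq_neg_iff_add_eq_0)
    have "pderiv (C * A ^ Suc m) = pderiv C * A ^ Suc m + of_nat (Suc m) * (A ^ m * pderiv A) * C"
      by (simp only: pderiv_mult pderiv_power_Suc of_nat_poly) (simp add: algebra_simps)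
    also have "\<dots> = A ^ m * (A * pderiv C - pderiv A * C)"
      unfolding p0 by (simp add: algebra_simps)
    finally have "pderiv (C * A ^ Suc m) = 0" by (simp add: True)
    then obtain E where E: "C * A ^ Suc m = E ^ ?p" by (rule pderiv_eq_0_imp_CHAR_power)
    have "((E - A) + A) ^ ?p = (E - A) ^ ?p + A ^ ?p"
      using pr by (intro freshmans_dream) auto
    then have "(E - A) ^ ?p = E ^ ?p - A ^ ?p"
      by (metis add_diff_cancel_right' diff_add_cancel)
    also have "\<dots> = (C - A) * A ^ Suc m"
      unfolding E[symmetric] by (simp add: m left_diff_distrib)
    finally have diff: "(E - A) ^ ?p = (C - A) * A ^ Suc m" .
    have "A \<noteq> E" 
      using diff \<open>A \<noteq> C\<close> nz p2 by (auto simp: power_0_left)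
    have "E \<noteq> 0" using E nz p2 by (auto simp: power_0_left)
    have "?p * degree E = degree C + (?p - 1) * degree A"
      using arg_cong[OF E, of degree] nz \<open>E \<noteq> 0\<close>
      by (simp add: degree_mult_eq degree_power_eq m del: power_Suc)
    then have d: "?p * degree E = ?p * degree A + d"
      using less.prems(1) by (simp add: m)
    then have "?p * degree A \<le> ?p * degree E" by simp
    then have le: "degree A \<le> degree E" using p2 by simp
    define e where "e = degree E - degree A"
    have dE: "degree E = degree A + e" using le by (simp add: e_def)
    have de: "d = ?p * e" using d by (simp add: dE algebra_simps)
    have e: "0 < e" "e < d" using less.prems(2) p2 by (auto simp: de)
    \<comment> \<open>As \<open>E^p = C * A^(p-1)\<close>, passing to \<open>E\<close> introduces no
      new irreducible factors, so the same \<open>R\<close> serves throughout the descent.\<close>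
    have "g dvd R" if g: "irreducible g" "g dvd A * E" for g
    proof -
      have pg: "prime_elem g" using g(1) by (rule field_poly_irreducible_imp_prime)
      have "g dvd A \<or> g dvd C"
      proof (cases "g dvd A")
        case False
        then have "g dvd E" using g pg by (simp add: prime_elem_dvd_mult_iff)
        then have "g dvd C * A ^ Suc m" unfolding E m by simp
        then show ?thesis
          using pg prime_elem_dvd_multD prime_elem_dvd_power by blast
      qed simp
      then show ?thesis using less.prems(3)[OF g(1)] by auto
    qed
    then obtain k where k: "?p ^ k dvd order 0 (E - A)" "?p ^ k dvd e"
      "order 0 (E - A) \<le> ?p ^ k * degree R"
      using less.IH[of e E] e dE \<open>A \<noteq> E\<close> by blast
    \<comment> \<open>The factor \<open>A ^ Suc m\<close> in \<open>diff\<close> does not affect the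
      order at 0.\<close>
    have "order 0 A = 0"
      using assms(2) by (intro order_0I) (simp add: poly_0_coeff_0)
    then have "order 0 (A ^ Suc m) = 0"
      using nz by (simp add: order_power del: power_Suc)
    then have ord: "order 0 (C - A) = ?p * order 0 (E - A)"
      using arg_cong[OF diff, of "order 0"] nz \<open>A \<noteq> C\<close> \<open>A \<noteq> E\<close>
      by (simp add: order_mult order_power del: power_Suc)
    show ?thesis
      using k de by (intro exI[of _ "Suc k"]) (simp add: ord mult_dvd_mono mult.assoc)
  qed
qed

section \<open>The common multiple \<open>R\<close> and its degree\<close>

lemma irreducible_dvd_prod_monom_card_power:
  fixes g :: "'a::{field, finite} poly"
  assumes "irreducible g" and "degree g \<le> M"
  shows "g dvd (\<Prod>i=1..M. monom 1 (card (UNIV :: 'a set) ^ i) - monom 1 1)"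
proof -
  have "g \<noteq> 0" using assms(1) by auto
  then have "degree g \<in> {1..M}"
    using assms by (auto simp: irreducible_def is_unit_iff_degree Suc_le_eq)
  then show ?thesis
    using irreducible_dvd_monom_card_power[OF assms(1)]
    by (meson dvd_prodI dvd_trans finite_atLeastAtMost)
qed

lemma degree_monom_power_diff:
  fixes q :: nat
  assumes "q \<ge> 2" and "i \<ge> 1"
  shows "degree (monom 1 (q ^ i) - monom 1 1 :: 'a::field poly) = q ^ i"
proof -
  have "(1::nat) < q ^ i" using assms by (intro one_less_power) auto
  then have "degree (monom 1 (q ^ i) + (- monom 1 1) :: 'a poly) = degree (monom (1::'a) (q ^ i))"
    by (intro degree_add_eq_left) (simp add: degree_monom_eq)
  then show ?thesis by (simp add: degree_monom_eq)
qed

lemma degree_prod_monom_power_diff: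
  fixes q M :: nat
  assumes "q \<ge> 2"
  defines "R \<equiv> \<Prod>i=1..M. monom 1 (q ^ i) - monom 1 1 :: 'a::field poly"
  shows "R \<noteq> 0" and "degree R < 2 * q ^ M"
proof -
  have nz: "monom 1 (q ^ i) - monom 1 1 \<noteq> (0 :: 'a poly)" if "i \<in> {1..M}" for i
  proof
    assume "monom 1 (q ^ i) - monom 1 1 = (0 :: 'a poly)"
    then have "q ^ i = 0" using degree_monom_power_diff[of q i, where 'a='a] assms(1) that by simp
    with assms(1) show False by simp
  qed
  then show "R \<noteq> 0" by (simp add: R_def)
  have "degree R = (\<Sum>i=1..M. degree (monom 1 (q ^ i) - monom 1 1 :: 'a poly))"
    unfolding R_def by (rule degree_prod_eq_sum_degree) (use nz in blast)
  also have "\<dots> = (\<Sum>i=1..M. q ^ i)"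
    using assms(1) by (intro sum.cong refl degree_monom_power_diff) auto
  also have "\<dots> < 2 * q ^ M"
  proof (induction M)
    case (Suc M)
    \<comment> \<open>The bound on the earlier terms is absorbed by the new last term, so the
      geometric sum stays below twice that term.\<close>
    have "2 * q ^ M \<le> q ^ Suc M" using mult_le_mono1[OF assms(1)] unfolding power_Suc .
    with Suc show ?case by (simp del: power_Suc)
  qed simp
  finally show "degree R < 2 * q ^ M" .
qed

lemma irreducible_dvd_degree_le_max_irred_degree:
  assumes "irreducible g" and "g dvd f" and "f \<noteq> 0"
  shows "degree g \<le> max_irred_degree f"
  unfolding max_irred_degree_def
proof (rule Max_ge)
  show "finite (degree ` {g. irreducible g \<and> g dvd f})"
    by (rule finite_subset[of _ "{..degree f}"]) (use assms(3) in \<open>auto intro: dvd_imp_degree_le\<close>)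
qed (use assms in auto)

theorem theorem3p1:
  fixes f :: "nat \<Rightarrow> 'a::{field, finite} poly"
    and p s q n d :: nat
  assumes "prime p" and "odd p" and "s \<ge> 1" and "q = p ^ s"
    and "card (UNIV :: 'a set) = q"
    and "consecutive_poly_seq f"
    and "n \<ge> 2 * q - 1"
    and "0 < d" and "real d \<le> ln ((real n + 1) / 2) / ln (real q)"
  shows "real (max (max_irred_degree (f n)) (max_irred_degree (f (n + d))))
           > (ln ((real n + 1) / 2) + ln (ln (real q)) - ln (ln ((real n + 1) / 2))) / ln (real q)
         \<and> (\<not> p dvd n + 1 \<or> \<not> p dvd d \<longrightarrow>
           real (max (max_irred_degree (f n)) (max_irred_degree (f (n + d))))
             > ln ((real n + 1) / 2) / ln (real q))"
proof -
  define M where "M = max (max_irred_degree (f n)) (max_irred_degree (f (n + d)))"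
  have "p ^ 1 \<le> p ^ s"
    using assms(3) prime_gt_0_nat[OF assms(1)] by (intro power_increasing) auto
  then have q: "q \<ge> 2" using prime_ge_2_nat[OF assms(1)] assms(4) by simp
  then have n: "n \<ge> 1" using assms(7) by linarith
  have char: "CHAR('a) = p"
    using assms(1,4,5) by (intro prime_card_imp_CHAR) auto
  obtain u where u: "\<And>i. u i \<noteq> 0" and f: "\<And>m. m \<ge> 1 \<Longrightarrow> f m = (\<Sum>i\<le>m. monom (u i) i)"
    using assms(6) unfolding consecutive_poly_seq_def by blast
  have coeff: "coeff (f m) j = (if j \<le> m then u j else 0)" if "m \<ge> 1" for m j
    by (simp add: f[OF that] coeff_sum)
  have deg: "degree (f m) = m" if "m \<ge> 1" for m
    using u that by (intro antisym degree_le le_degree) (auto simp: coeff)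
  have neq: "f (n + d) - f n \<noteq> 0"
    using deg[of n] deg[of "n + d"] n assms(8) by auto
  \<comment> \<open>The coefficient of \<open>X^(n+1)\<close> in the difference is
    \<open>u (n+1)\<close>, which is nonzero, so the order is exact.\<close>
  have "monom 1 (Suc n) dvd f (n + d) - f n" "\<not> monom 1 (Suc (Suc n)) dvd f (n + d) - f n"
    using n assms(8) u by (auto simp: monom_1_dvd_iff' coeff intro!: exI[of _ "Suc n"])
  then have order: "order 0 (f (n + d) - f n) = n + 1"
    using neq by (simp add: monom_1_dvd_iff)
  define R :: "'a poly" where "R = (\<Prod>i=1..M. monom 1 (q ^ i) - monom 1 1)"
  have R: "R \<noteq> 0" "degree R < 2 * q ^ M"
    unfolding R_def using degree_prod_monom_power_diff[OF q] by auto
  have "g dvd R" if g: "irreducible g" "g dvd f n * f (n + d)" for g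
  proof -
    have "f n \<noteq> 0" "f (n + d) \<noteq> 0" using deg[of n] deg[of "n + d"] n by auto
    moreover have "g dvd f n \<or> g dvd f (n + d)"
      using g field_poly_irreducible_imp_prime prime_elem_dvd_multD by blast
    ultimately have "degree g \<le> M"
      using irreducible_dvd_degree_le_max_irred_degree[OF g(1)] by (auto simp: M_def le_max_iff_disj)
    with g(1) show ?thesis
      unfolding R_def assms(5)[symmetric] by (rule irreducible_dvd_prod_monom_card_power)
  qed
  then obtain k where k: "p ^ k dvd n + 1" "p ^ k dvd d" "n + 1 \<le> p ^ k * degree R"
    using order_diff_le_CHAR_power[of R "f n" "f (n + d)" d] R neq n assms(8) u
    unfolding char order by (auto simp: coeff deg)
  have p0: "0 < p ^ k" using prime_gt_0_nat[OF assms(1)] by simp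
  have bound: "n + 1 < p ^ k * (2 * q ^ M)"
    using k(3) R(2) p0 by (meson le_less_trans mult_less_mono2)
  define L where "L = ln ((real n + 1) / 2)"
  have b: "ln (real q) > 0" using q by simp
  \<comment> \<open>This is where \<open>n >= 2q - 1\<close> enters: it makes \<open>L\<close>
    positive, so that \<open>ln L\<close> is a genuine logarithm.\<close>
  have "real q \<le> (real n + 1) / 2" using assms(7) by simp
  then have "ln (real q) \<le> L" unfolding L_def using q by (intro ln_mono) auto
  with b have L: "L > 0" by linarith
  \<comment> \<open>Used with \<open>c = d\<close> for the general bound and with
    \<open>c = 1\<close> for the sharper one.\<close>
  have less: "L < ln (real c) + real M * ln (real q)" if "n + 1 < c * (2 * q ^ M)" for c
  proof -
    have c: "c > 0" using that by (intro gr0I) auto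
    have "real (n + 1) < real (c * (2 * q ^ M))" using that by (simp only: of_nat_less_iff)
    then have "(real n + 1) / 2 < real c * real q ^ M" by simp
    then have "L < ln (real c * real q ^ M)" unfolding L_def by (subst ln_less_cancel_iff) auto
    also have "\<dots> = ln (real c) + real M * ln (real q)"
      using c q by (simp add: ln_mult ln_realpow)
    finally show ?thesis .
  qed
  have "p ^ k \<le> d" using k(2) assms(8) by (rule dvd_imp_le)
  then have "n + 1 < d * (2 * q ^ M)"
    using bound by (meson less_le_trans mult_le_mono1)
  \<comment> \<open>The upper bound on \<open>d\<close> turns the loss \<open>ln d\<close> into the
    double logarithms of the claim.\<close>
  moreover have "ln (real d) \<le> ln (L / ln (real q))"
    using assms(8,9) by (intro ln_mono) (auto simp: L_def)
  moreover have "ln (L / ln (real q)) = ln L - ln (ln (real q))"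
    using L b by (simp add: ln_div)
  ultimately have "L + ln (ln (real q)) - ln L < real M * ln (real q)"
    using less by fastforce
  moreover have "L < real M * ln (real q)" if "\<not> p dvd n + 1 \<or> \<not> p dvd d"
  proof -
    \<comment> \<open>For positive \<open>k\<close>, \<open>p\<close> would divide both
      \<open>n + 1\<close> and \<open>d\<close>.\<close>
    have "k = 0"
      using that k(1,2) by (metis dvd_power dvd_trans gr0I)
    then show ?thesis using less[of 1] bound by simp
  qed
  ultimately show ?thesis
    using b by (simp add: divide_less_eq flip: M_def L_def)
qed

end
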